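(* For every integer $d\geq 2$ and every integer $N$, there exists a $(d+1)$-dimensional simplicial polytope $\mathbf{P}$ with at least $N$ vertices such that $\tau(\mathcal{F}(\mathbf{P}))/n=\frac{2}{d+2}$ exactly, where $n$ is the number of vertices of $\mathbf{P}$. (That is, there are infinitely many $(d+1)$-dimensional simplicial polytopes with transversal ratio exactly $\frac{2}{d+2}$.)
   Context: For a polytope $\mathbf{P}$, the facet hypergraph $\mathcal{F}(\mathbf{P})$ is the hypergraph on the vertex set of $\mathbf{P}$ whose hyperedges are the vertex sets of the facets of $\mathbf{P}$. For a hypergraph $\mathcal{H}$, a transversal is a set $T\subseteq V(\mathcal{H})$ meeting every hyperedge, and $\tau(\mathcal{H})$ is the minimum size of a transversal. The transversal ratio of $\mathbf{P}$ is $\tau(\mathcal{F}(\mathbf{P}))/n$ where $n$ is its number of vertices. *)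

theory Defs
  imports "HOL-Analysis.Analysis"
begin

definition vertices :: "'a::euclidean_space set \<Rightarrow> 'a set" where
  "vertices P = {v. v extreme_point_of P}"

definition simplicial_polytope :: "'a::euclidean_space set \<Rightarrow> bool" where
  "simplicial_polytope P \<longleftrightarrow> polytope P \<and> (\<forall>F. F facet_of P \<longrightarrow> (aff_dim F) simplex F)"

definition facet_hypergraph_edges :: "'a::euclidean_space set \<Rightarrow> 'a set set" where
  "facet_hypergraph_edges P = {vertices F | F. F facet_of P}"

definition is_transversal :: "'a::euclidean_space set \<Rightarrow> 'a set \<Rightarrow> bool" where
  "is_transversal P T \<longleftrightarrow> T \<subseteq> vertices P \<and> (\<forall>E \<in> facet_hypergraph_edges P. T \<inter> E \<noteq> {})"

definition transversal_number :: "'a::euclidean_space set \<Rightarrow> nat" where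
  "transversal_number P = (LEAST k. \<exists>T. is_transversal P T \<and> card T = k)"

end

theory Submission
  imports Defs
begin

text \<open>Start with a simplex and repeat the following step: onto a facet \<open>F\<close> glue a thin cross-polytope,
  with new vertices \<open>w f\<close> antipodal to the vertices \<open>f\<close> of \<open>F\<close>, and then stack one more vertex \<open>t\<close> onto the
  opposite facet \<open>w ` F\<close>. This adds \<open>d + 2\<close> vertices and raises the transversal number by exactly two.
  A transversal \<open>T\<close> containing two vertices \<open>f, g\<close> of \<open>F\<close> extends by \<open>w f, w g\<close>. Conversely, every
  transversal contains at least two new vertices unless \<open>t\<close> is the only one, in which case it contains \<open>F\<close>
  and is larger than minimal on the old vertices; and if it misses \<open>F\<close>, then it contains \<open>w ` F\<close>,
  hence at least three new vertices, while one more old vertex would give a transversal of the old polytope.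

  Convexity of the glued polytope is ensured by flattening the cross-polytope towards the centroid
  of \<open>F\<close>.\<close>

subsection \<open>Simplicial polytopes given by facet inequalities\<close>

text \<open>Members of \<open>\<E>\<close> are the vertex sets of the facets, each with an explicit
  supporting hyperplane. By \<open>complete\<close> these inequalities cut out the hull, so that
  convexity of a glued polytope becomes a matter of inequalities.\<close>

locale facet_system =
  fixes V :: "'a::euclidean_space set" and \<E> :: "'a set set"
    and a :: "'a set \<Rightarrow> 'a" and b :: "'a set \<Rightarrow> real"
  assumes finite_V: "finite V"
    and nonempty: "\<E> \<noteq> {}"
    and Union_eq: "\<Union>\<E> = V"
    and proper: "E \<in> \<E> \<Longrightarrow> E \<noteq> V"
    and card_facet: "E \<in> \<E> \<Longrightarrow> card E = DIM('a)"
    and indep: "E \<in> \<E> \<Longrightarrow> \<not> affine_dependent E"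
    and on: "E \<in> \<E> \<Longrightarrow> v \<in> E \<Longrightarrow> a E \<bullet> v = b E"
    and below: "E \<in> \<E> \<Longrightarrow> v \<in> V \<Longrightarrow> v \<notin> E \<Longrightarrow> a E \<bullet> v < b E"
    and complete: "(\<And>E. E \<in> \<E> \<Longrightarrow> a E \<bullet> x \<le> b E) \<Longrightarrow> x \<in> convex hull V"
begin

lemma facet_subset: "E \<in> \<E> \<Longrightarrow> E \<subseteq> V"
  using Union_eq by blast

lemma finite_facets: "finite \<E>"
  by (rule finite_subset[of _ "Pow V"]) (use facet_subset finite_V in auto)

lemma hull_le: "E \<in> \<E> \<Longrightarrow> x \<in> convex hull V \<Longrightarrow> a E \<bullet> x \<le> b E"
proof -
  assume E: "E \<in> \<E>" and x: "x \<in> convex hull V"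
  have "V \<subseteq> {x. a E \<bullet> x \<le> b E}"
    using on[OF E] below[OF E] by (force simp: less_imp_le)
  then have "convex hull V \<subseteq> {x. a E \<bullet> x \<le> b E}"
    by (intro hull_minimal convex_halfspace_le)
  with x show ?thesis by auto
qed

lemma affine_hull_facet: "E \<in> \<E> \<Longrightarrow> affine hull E \<subseteq> {x. a E \<bullet> x = b E}"
  by (intro hull_minimal affine_hyperplane) (use on in auto)

lemma face: assumes E: "E \<in> \<E>" shows "convex hull E face_of convex hull V"
proof (rule face_of_convex_hulls[OF finite_V facet_subset[OF E]])
  have "convex hull (V - E) \<subseteq> {x. a E \<bullet> x < b E}"
    by (intro hull_minimal convex_halfspace_lt) (use below[OF E] in auto)
  then show "affine hull E \<inter> convex hull (V - E) = {}"
    using affine_hull_facet[OF E] by fastforce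
qed

lemma aff_dim_facet: "E \<in> \<E> \<Longrightarrow> aff_dim (convex hull E) = int (DIM('a)) - 1"
  using aff_dim_affine_independent[OF indep] card_facet by (force simp: aff_dim_convex_hull)

text \<open>A vertex off the hyperplane of a facet adds the missing dimension.\<close>

lemma aff_dim_hull: "aff_dim (convex hull V) = int (DIM('a))"
proof -
  obtain E where E: "E \<in> \<E>" using nonempty by blast
  obtain v where v: "v \<in> V" "v \<notin> E" using facet_subset[OF E] proper[OF E] by blast
  have "v \<notin> affine hull E"
    using affine_hull_facet[OF E] below[OF E v] by auto
  then have "aff_dim (insert v E) = int (DIM('a))"
    using aff_dim_facet[OF E] by (simp add: aff_dim_insert aff_dim_convex_hull)
  moreover have "aff_dim (insert v E) \<le> aff_dim V"
    using v facet_subset[OF E] by (intro aff_dim_subset) auto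
  ultimately show ?thesis
    using aff_dim_le_DIM[of V] by (simp add: aff_dim_convex_hull)
qed

text \<open>A relative interior point \<open>x\<close> of a facet \<open>G\<close> lies on the
  boundary of the hull, so one of the inequalities is tight at \<open>x\<close>. The face
  \<open>H\<close> cut out by its hyperplane contains both \<open>G\<close> and
  \<open>convex hull E\<close>; all three have codimension one and therefore coincide.\<close>

lemma facet_of_hull_iff: "G facet_of convex hull V \<longleftrightarrow> (\<exists>E\<in>\<E>. G = convex hull E)"
proof
  assume "\<exists>E\<in>\<E>. G = convex hull E"
  then obtain E where E: "E \<in> \<E>" "G = convex hull E" by blast
  then have "E \<noteq> {}" using card_facet[of E] by auto
  then show "G facet_of convex hull V"
    unfolding facet_of_def using face aff_dim_facet aff_dim_hull E by auto
next
  assume G: "G facet_of convex hull V"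
  then have Gf: "G face_of convex hull V" and "G \<noteq> {}"
    and Gd: "aff_dim G = int (DIM('a)) - 1"
    using aff_dim_hull by (auto simp: facet_of_def)
  have "convex G" using Gf face_of_imp_convex by blast
  then obtain x where x: "x \<in> rel_interior G"
    using \<open>G \<noteq> {}\<close> rel_interior_eq_empty by blast
  have xG: "x \<in> G" using x rel_interior_subset by blast
  have GV: "G \<subseteq> convex hull V" using Gf face_of_imp_subset by blast
  have "G \<noteq> convex hull V" using Gd aff_dim_hull by auto
  then have "x \<notin> interior (convex hull V)"
    using face_of_disjoint_interior[OF Gf] xG by blast
  \<comment> \<open>There are finitely many strict inequalities, so they define an open subset of
    the hull, hence of its interior.\<close>
  moreover have "open {y. \<forall>E\<in>\<E>. a E \<bullet> y < b E}"
    unfolding Collect_ball_eq using finite_facets by (intro open_INT) (auto intro: open_halfspace_lt)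
  moreover have "{y. \<forall>E\<in>\<E>. a E \<bullet> y < b E} \<subseteq> convex hull V"
    using complete less_imp_le by blast
  ultimately have "\<not> (\<forall>E\<in>\<E>. a E \<bullet> x < b E)"
    using interior_maximal by blast
  then obtain E where E: "E \<in> \<E>" "a E \<bullet> x = b E"
    using hull_le xG GV by fastforce
  define H where "H = convex hull V \<inter> {y. a E \<bullet> y = b E}"
  have Hf: "H face_of convex hull V"
    unfolding H_def by (intro face_of_Int_supporting_hyperplane_le hull_le E convex_convex_hull)
  have EH: "convex hull E \<subseteq> H"
    using convex_hull_subset_affine_hull[of E] affine_hull_facet[OF E(1)] face[OF E(1)] face_of_imp_subset
    unfolding H_def by blast
  \<comment> \<open>A face of the hull that meets the relative interior of \<open>G\<close> contains
    \<open>G\<close>.\<close>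
  have GH: "G \<subseteq> H"
    by (rule subset_of_face_of[OF Hf GV]) (use x xG GV E H_def in auto)
  have "H \<noteq> convex hull V"
  proof
    assume "H = convex hull V"
    then have "V \<subseteq> {y. a E \<bullet> y = b E}" unfolding H_def using hull_subset[of V convex] by blast
    then show False using facet_subset[OF E(1)] proper[OF E(1)] below[OF E(1)] by fastforce
  qed
  then have Hd: "aff_dim H \<le> int (DIM('a)) - 1"
    using face_of_aff_dim_lt[OF convex_convex_hull Hf] aff_dim_hull by auto
  have cH: "convex H" using Hf face_of_imp_convex by blast
  have HV: "H \<subseteq> convex hull V" unfolding H_def by blast
  have "G = H"
    using face_of_aff_dim_lt[OF cH face_of_subset[OF Gf GH HV]] Gd Hd by force
  moreover have "convex hull E = H"
    using face_of_aff_dim_lt[OF cH face_of_subset[OF face[OF E(1)] EH HV]] aff_dim_facet[OF E(1)] Hd by force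
  ultimately show "\<exists>E\<in>\<E>. G = convex hull E" using E by blast
qed

lemma vertices_facet: "E \<in> \<E> \<Longrightarrow> vertices (convex hull E) = E"
  unfolding vertices_def using extreme_point_of_convex_hull_affine_independent[OF indep] by auto

lemma vertices_hull: "vertices (convex hull V) = V"
proof
  show "vertices (convex hull V) \<subseteq> V"
    unfolding vertices_def using extreme_point_of_convex_hull by blast
  show "V \<subseteq> vertices (convex hull V)"
  proof
    fix v assume "v \<in> V"
    then obtain E where E: "E \<in> \<E>" "v \<in> E" using Union_eq by blast
    then have "v extreme_point_of (convex hull E)"
      using extreme_point_of_convex_hull_affine_independent[OF indep] by blast
    then show "v \<in> vertices (convex hull V)"
      using extreme_point_of_face[OF face[OF E(1)]] by (auto simp: vertices_def)
  qed
qed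

lemma facet_hypergraph_edges_hull: "facet_hypergraph_edges (convex hull V) = \<E>"
proof -
  have "facet_hypergraph_edges (convex hull V) = (\<lambda>E. vertices (convex hull E)) ` \<E>"
    unfolding facet_hypergraph_edges_def by (auto simp: facet_of_hull_iff)
  then show ?thesis using vertices_facet by simp
qed

lemma simplicial: "simplicial_polytope (convex hull V)"
  unfolding simplicial_polytope_def
proof (intro conjI allI impI)
  show "polytope (convex hull V)" using finite_V polytope_convex_hull by blast
  fix G assume "G facet_of convex hull V"
  then obtain E where E: "E \<in> \<E>" "G = convex hull E" using facet_of_hull_iff by blast
  then show "aff_dim G simplex G"
    using simplex_convex_hull indep card_facet aff_dim_facet by force
qed

end

text \<open>Gluing along \<open>F\<close>: a point satisfying all remaining inequalities lies in one polytope or in the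
  other, according to the side of the hyperplane of \<open>F\<close>.\<close>

lemma facet_system_glue:
  fixes V W :: "'a::euclidean_space set"
  assumes P: "facet_system V \<E> a b" and Q: "facet_system (F \<union> W) \<C> p q"
    and F: "F \<in> \<E>" "F \<in> \<C>" and WV: "W \<inter> V = {}" and W: "W \<noteq> {}"
    and opp: "\<And>x. b F \<le> a F \<bullet> x \<Longrightarrow> p F \<bullet> x \<le> q F"
    and W_below: "\<And>E w. E \<in> \<E> - {F} \<Longrightarrow> w \<in> W \<Longrightarrow> a E \<bullet> w < b E"
    and V_below: "\<And>E v. E \<in> \<C> - {F} \<Longrightarrow> v \<in> V - F \<Longrightarrow> p E \<bullet> v < q E"
    and F_cover: "F \<subseteq> \<Union>(\<C> - {F})"
  shows "\<exists>a' b'. facet_system (V \<union> W) ((\<E> - {F}) \<union> (\<C> - {F})) a' b'"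
proof -
  interpret P: facet_system V \<E> a b by fact
  interpret Q: facet_system "F \<union> W" \<C> p q by fact
  have FV: "F \<subseteq> V" using P.facet_subset F by blast
  have finF: "finite F" using FV P.finite_V finite_subset by blast
  \<comment> \<open>Points of \<open>W\<close> are new, so a member inside \<open>V\<close> would
    lie in \<open>F\<close> and equal it by cardinality. The test \<open>E \<subseteq> V\<close>
    therefore tells the two families apart.\<close>
  have C_notin: "\<not> E \<subseteq> V" if "E \<in> \<C> - {F}" for E
  proof
    assume "E \<subseteq> V"
    moreover have "E \<subseteq> F \<union> W" using Q.facet_subset that by blast
    ultimately have "E \<subseteq> F" using WV by blast
    moreover have "card E = card F" using Q.card_facet that F by simp
    ultimately have "E = F" using card_subset_eq[OF finF] by blast
    with that show False by blast
  qed
  define a' where "a' E = (if E \<subseteq> V then a E else p E)" for E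
  define b' where "b' E = (if E \<subseteq> V then b E else q E)" for E
  have P': "a' E = a E" "b' E = b E" if "E \<in> \<E> - {F}" for E
    using P.facet_subset that by (auto simp: a'_def b'_def)
  have Q': "a' E = p E" "b' E = q E" if "E \<in> \<C> - {F}" for E
    using C_notin[OF that] by (auto simp: a'_def b'_def)
  have W_cover: "W \<subseteq> \<Union>(\<C> - {F})"
  proof
    fix w assume w: "w \<in> W"
    then obtain E where "E \<in> \<C>" "w \<in> E" using Q.Union_eq by auto
    moreover have "w \<notin> F" using w WV FV by auto
    ultimately show "w \<in> \<Union>(\<C> - {F})" by auto
  qed
  have "facet_system (V \<union> W) ((\<E> - {F}) \<union> (\<C> - {F})) a' b'"
  proof
    show "finite (V \<union> W)" using P.finite_V Q.finite_V by simp
    show "(\<E> - {F}) \<union> (\<C> - {F}) \<noteq> {}"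
    proof -
      have "\<C> - {F} \<noteq> {}" using W_cover W by auto
      then show ?thesis by simp
    qed
    show "\<Union> ((\<E> - {F}) \<union> (\<C> - {F})) = V \<union> W" (is "?L = _")
    proof
      show "?L \<subseteq> V \<union> W"
        using P.facet_subset Q.facet_subset FV by (intro Union_least) blast
      have "V \<subseteq> \<Union>(\<E> - {F}) \<union> F" using P.Union_eq by auto
      then show "V \<union> W \<subseteq> ?L"
        unfolding Union_Un_distrib using W_cover F_cover by (meson Un_least le_supI2 order_trans sup_mono order_refl)
    qed
    fix E assume E: "E \<in> (\<E> - {F}) \<union> (\<C> - {F})"
    show "E \<noteq> V \<union> W"
    proof
      assume eq: "E = V \<union> W"
      have "E \<in> \<E> - {F} \<Longrightarrow> False" using P.facet_subset[of E] eq W WV by blast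
      moreover have "E \<in> \<C> - {F} \<Longrightarrow> False"
        using Q.proper[of E] Q.facet_subset[of E] eq FV by blast
      ultimately show False using E by blast
    qed
    show "card E = DIM('a)" "\<not> affine_dependent E"
      using E P.card_facet Q.card_facet P.indep Q.indep by auto
    show "a' E \<bullet> v = b' E" if "v \<in> E" for v
      using E
    proof
      assume "E \<in> \<E> - {F}"
      then show ?thesis using P.on[of E v] that P'[of E] by simp
    next
      assume "E \<in> \<C> - {F}"
      then show ?thesis using Q.on[of E v] that Q'[of E] by simp
    qed
    show "a' E \<bullet> v < b' E" if v: "v \<in> V \<union> W" "v \<notin> E" for v
      using E
    proof
      assume "E \<in> \<E> - {F}"
      then show ?thesis using P.below[of E v] v P'[of E] W_below[of E v] by auto
    next
      assume "E \<in> \<C> - {F}"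
      then show ?thesis using Q.below[of E v] v Q'[of E] V_below[of E v] by auto
    qed
  next
    fix x assume x: "\<And>E. E \<in> (\<E> - {F}) \<union> (\<C> - {F}) \<Longrightarrow> a' E \<bullet> x \<le> b' E"
    show "x \<in> convex hull (V \<union> W)"
    proof (cases "a F \<bullet> x \<le> b F")
      case True
      have "a E \<bullet> x \<le> b E" if "E \<in> \<E>" for E
        using x[of E] P'[of E] True that by (cases "E = F") simp_all
      then show ?thesis using P.complete hull_mono[of V "V \<union> W" convex] by blast
    next
      case False
      have "p E \<bullet> x \<le> q E" if "E \<in> \<C>" for E
        using x[of E] Q'[of E] opp[of x] False that by (cases "E = F") simp_all
      then show ?thesis using Q.complete hull_mono[of "F \<union> W" "V \<union> W" convex] FV by blast
    qed
  qed
  then show ?thesis by blast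
qed

subsection \<open>Coordinates adapted to a facet\<close>

text \<open>A hyperplane through the other points contains their affine hull and so keeps
  \<open>v\<close> out of it. The coordinate and height functionals of the charts below supply such
  hyperplanes.\<close>

lemma affine_independent_if_separated:
  fixes E :: "'a::euclidean_space set"
  assumes "\<And>v. v \<in> E \<Longrightarrow> \<exists>p q. p \<bullet> v \<noteq> q \<and> (\<forall>x\<in>E - {v}. p \<bullet> x = q)"
  shows "\<not> affine_dependent E"
proof
  assume "affine_dependent E"
  then obtain v where v: "v \<in> E" "v \<in> affine hull (E - {v})"
    unfolding affine_dependent_def by blast
  obtain p q where pq: "p \<bullet> v \<noteq> q" "\<forall>x\<in>E - {v}. p \<bullet> x = q" using assms[OF v(1)] by blast
  have "affine hull (E - {v}) \<subseteq> {x. p \<bullet> x = q}"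
    by (intro hull_minimal affine_hyperplane) (use pq in auto)
  then show False using v pq by auto
qed

lemma convex_add_combination:
  fixes z :: "'i \<Rightarrow> 'a::real_vector"
  assumes "convex S" "p \<in> S" "finite I"
    and "\<And>i. i \<in> I \<Longrightarrow> 0 \<le> c i" "sum c I \<le> 1" "\<And>i. i \<in> I \<Longrightarrow> z i \<in> S"
  shows "p + (\<Sum>i\<in>I. c i *\<^sub>R (z i - p)) \<in> S"
proof -
  \<comment> \<open>The leftover weight \<open>1 - sum c I\<close> goes to \<open>p\<close>, which
    gets the separate index \<open>None\<close>.\<close>
  define c' where "c' j = (case j of None \<Rightarrow> 1 - sum c I | Some i \<Rightarrow> c i)" for j
  define z' where "z' j = (case j of None \<Rightarrow> p | Some i \<Rightarrow> z i)" for j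
  have *: "sum g (insert None (Some ` I)) = g None + (\<Sum>i\<in>I. g (Some i))" for g :: "'i option \<Rightarrow> 'b::comm_monoid_add"
    using assms(3) by (subst sum.insert) (auto simp: sum.reindex)
  have "(\<Sum>j\<in>insert None (Some ` I). c' j *\<^sub>R z' j) \<in> S"
    by (intro convex_sum assms(1)) (use assms in \<open>auto simp: * c'_def z'_def\<close>)
  moreover have "(\<Sum>j\<in>insert None (Some ` I). c' j *\<^sub>R z' j) = p + (\<Sum>i\<in>I. c i *\<^sub>R (z i - p))"
    unfolding * by (simp add: c'_def z'_def algebra_simps sum_subtractf scaleR_left.sum)
  ultimately show ?thesis by simp
qed

text \<open>New vertices move linearly with the thickness \<open>e\<close>, so a strict inequality
  that holds in the flat limit persists for small \<open>e\<close>.\<close>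

lemma eventually_at_right_0_linear_less:
  fixes A B k :: real
  assumes "A < B"
  shows "\<forall>\<^sub>F e in at_right 0. A + e * k < B"
proof -
  have "((\<lambda>e. A + e * k) \<longlongrightarrow> A + 0 * k) (at_right 0)"
    by (intro tendsto_intros)
  then show ?thesis using assms by (intro order_tendstoD) auto
qed

text \<open>For small \<open>e\<close> the negative term outweighs every constant. It arises from
  old vertices, whose negative height over the facet is divided by \<open>e\<close> in the new facet
  inequalities.\<close>

lemma eventually_at_right_0_inverse_less:
  fixes A B k :: real
  assumes "k < 0"
  shows "\<forall>\<^sub>F e in at_right 0. A + k / e < B"
proof -
  have "\<forall>\<^sub>F e in at_right 0. k + e * (A - B) < 0"
    using eventually_at_right_0_linear_less[OF assms] .
  moreover have "\<forall>\<^sub>F e in at_right (0::real). 0 < e"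
    by (simp add: eventually_at_right_less)
  ultimately show ?thesis
    by eventually_elim (simp add: field_simps)
qed

text \<open>The facet \<open>E\<close> has as many vertices as \<open>F\<close>, so it misses a
  vertex of \<open>F\<close>, which carries positive weight. This strictness at relative interior
  points of \<open>F\<close> is the room in which the glued polytope fits.\<close>

lemma (in facet_system) positive_combination_below:
  assumes E: "E \<in> \<E>" and F: "F \<in> \<E>" "E \<noteq> F"
    and \<mu>: "\<And>f. f \<in> F \<Longrightarrow> 0 < \<mu> f" "sum \<mu> F = 1"
  shows "a E \<bullet> (\<Sum>f\<in>F. \<mu> f *\<^sub>R f) < b E"
proof -
  have finF: "finite F" "finite E" using facet_subset finite_V finite_subset E F by metis+
  have "\<not> F \<subseteq> E"
    using card_subset_eq[OF finF(2)] card_facet E F by metis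
  then obtain g where g: "g \<in> F" "g \<notin> E" by blast
  have "(\<Sum>f\<in>F. \<mu> f * (a E \<bullet> f)) < (\<Sum>f\<in>F. \<mu> f * b E)"
  proof (rule sum_strict_mono_ex1[OF finF(1)])
    show "\<forall>f\<in>F. \<mu> f * (a E \<bullet> f) \<le> \<mu> f * b E"
    proof
      fix f assume f: "f \<in> F"
      then have "f \<in> V" using facet_subset F by blast
      then have "a E \<bullet> f \<le> b E" using hull_le[OF E] hull_inc by metis
      then show "\<mu> f * (a E \<bullet> f) \<le> \<mu> f * b E" using \<mu>(1)[OF f] by simp
    qed
    have "g \<in> V" using g facet_subset F by blast
    then show "\<exists>f\<in>F. \<mu> f * (a E \<bullet> f) < \<mu> f * b E"
      using g below[OF E, of g] \<mu>(1) by auto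
  qed
  also have "\<dots> = b E" by (simp add: \<mu> flip: sum_distrib_right)
  finally show ?thesis by (simp add: inner_sum_right)
qed

text \<open>The values \<open>l f \<bullet> x + m f\<close> are the barycentric coordinates, with
  respect to \<open>F\<close>, of the projection of \<open>x\<close> along \<open>u\<close> to the
  hyperplane of \<open>F\<close>; \<open>a \<bullet> x - b\<close> is the height over it.\<close>

locale facet_chart =
  fixes F :: "'a::euclidean_space set" and a u :: 'a and b :: real
    and l :: "'a \<Rightarrow> 'a" and m :: "'a \<Rightarrow> real"
  assumes finite_F: "finite F" and card_F: "card F = DIM('a)"
    and a_F: "f \<in> F \<Longrightarrow> a \<bullet> f = b"
    and a_u: "a \<bullet> u = 1"
    and l_F: "f \<in> F \<Longrightarrow> g \<in> F \<Longrightarrow> l f \<bullet> g + m f = of_bool (f = g)"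
    and l_u: "f \<in> F \<Longrightarrow> l f \<bullet> u = 0"
    and sum_l: "(\<Sum>f\<in>F. l f \<bullet> x + m f) = 1"
    and l_repr: "x = (\<Sum>f\<in>F. (l f \<bullet> x + m f) *\<^sub>R f) + (a \<bullet> x - b) *\<^sub>R u"

text \<open>Seen from the point \<open>p\<close> at height one over the centroid, the vectors
  \<open>f - p\<close> form a basis. Its dual functionals \<open>k f\<close> become the barycentric
  coordinates once a multiple of \<open>a\<close> is added that makes them vanish on
  \<open>u\<close>.\<close>

lemma facet_chart_exists:
  fixes F :: "'a::euclidean_space set"
  assumes indep: "\<not> affine_dependent F" and card_F: "card F = DIM('a)"
    and a_F: "\<And>f. f \<in> F \<Longrightarrow> a \<bullet> f = b" and a0: "a \<noteq> 0"
  shows "\<exists>u l m. facet_chart F a u b l m"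
proof -
  define D where "D = real (DIM('a))"
  have D: "D > 0" "real (card F) = D" by (auto simp: D_def card_F)
  have finF: "finite F" using indep aff_independent_finite by blast
  define u where "u = (1 / (a \<bullet> a)) *\<^sub>R a"
  have au: "a \<bullet> u = 1" using a0 by (simp add: u_def)
  define c where "c = (1 / D) *\<^sub>R (\<Sum>f\<in>F. f)"
  have ac: "a \<bullet> c = b" using D by (simp add: c_def inner_sum_right a_F)
  define p where "p = c + u"
  have ap: "a \<bullet> p = b + 1" by (simp add: p_def inner_add_right ac au)
  have "affine hull F \<subseteq> {x. a \<bullet> x = b}"
    by (intro hull_minimal affine_hyperplane) (use a_F in auto)
  then have pF: "p \<notin> affine hull F" using ap by auto
  then have pF': "p \<notin> F" using hull_inc by metis
  define B where "B = (\<lambda>x. - p + x) ` F"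
  have "\<not> affine_dependent (insert p F)"
    using affine_independent_insert[OF indep pF] .
  then have indB: "independent B"
    using affine_dependent_iff_dependent[OF pF'] B_def by blast
  have cardB: "card B = DIM('a)"
    unfolding B_def by (subst card_image) (auto simp: card_F inj_on_def)
  have spanB: "span B = UNIV"
    using indB cardB by (metis dim_UNIV dim_eq_card_independent dim_eq_full dim_span)
  have "\<exists>r. linear r \<and> (\<forall>x\<in>B. r x = (of_bool (x = - p + f) :: real))" for f
    using linear_independent_extend[OF indB, of "\<lambda>x. of_bool (x = - p + f)"] by blast
  then obtain r where r: "\<And>f. linear (r f)" "\<And>f x. x \<in> B \<Longrightarrow> r f x = (of_bool (x = - p + f) :: real)"
    by metis
  \<comment> \<open>The adjoint at \<open>1\<close> is the vector that represents the functional
    \<open>r f\<close>.\<close>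
  define k where "k f = adjoint (r f) 1" for f
  have k: "k f \<bullet> x = r f x" for f x
    using adjoint_works[OF r(1), of x f 1] by (simp add: k_def inner_commute)
  have kF: "k f \<bullet> (g - p) = of_bool (f = g)" if "f \<in> F" "g \<in> F" for f g
    unfolding k using r(2)[of "- p + g" f] that by (auto simp: B_def)
  have rep0: "(\<Sum>f\<in>F. (k f \<bullet> x) *\<^sub>R (f - p)) = x" for x
  proof -
    have "linear (\<lambda>x. \<Sum>f\<in>F. (k f \<bullet> x) *\<^sub>R (f - p))"
      by (intro linear_compose_sum ballI linearI)
        (auto simp: inner_add_right scaleR_add_left)
    moreover have "(\<Sum>f\<in>F. (k f \<bullet> x) *\<^sub>R (f - p)) = x" if x: "x \<in> B" for x
    proof -
      obtain g where g: "g \<in> F" "x = g - p" using x by (auto simp: B_def)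
      have "(\<Sum>f\<in>F. (k f \<bullet> x) *\<^sub>R (f - p)) = (\<Sum>f\<in>F. if f = g then f - p else 0)"
        using g by (intro sum.cong) (auto simp: kF)
      also have "\<dots> = x" using g finF by simp
      finally show ?thesis .
    qed
    ultimately show ?thesis
      using linear_eq_on_span[of "\<lambda>x. \<Sum>f\<in>F. (k f \<bullet> x) *\<^sub>R (f - p)" "\<lambda>x. x" B x] spanB linear_id
      by (auto simp: id_def)
  qed
  \<comment> \<open>Each \<open>f - p\<close> has inner product \<open>-1\<close> with
    \<open>a\<close>, so applying \<open>a\<close> to the expansion of \<open>x\<close> yields the
    coefficient sum.\<close>
  have sum_k: "(\<Sum>f\<in>F. k f \<bullet> x) = - (a \<bullet> x)" for x
  proof -
    have "a \<bullet> x = a \<bullet> (\<Sum>f\<in>F. (k f \<bullet> x) *\<^sub>R (f - p))" by (simp add: rep0)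
    also have "\<dots> = (\<Sum>f\<in>F. - (k f \<bullet> x))"
      unfolding inner_sum_right by (intro sum.cong) (auto simp: inner_diff_right a_F ap)
    finally show ?thesis by (simp add: sum_negf)
  qed
  have ku: "k f \<bullet> u = - 1 / D" if f: "f \<in> F" for f
  proof -
    have "(\<Sum>g\<in>F. g - p) = - D *\<^sub>R u"
      using D by (simp add: sum_subtractf c_def p_def sum_constant_scaleR scaleR_add_right)
    then have "k f \<bullet> (- D *\<^sub>R u) = (\<Sum>g\<in>F. k f \<bullet> (g - p))" by (metis inner_sum_right)
    also have "\<dots> = 1" using f finF by (simp add: kF of_bool_def)
    finally show ?thesis using D by (simp add: field_simps)
  qed
  \<comment> \<open>The correction \<open>a / D\<close> cancels
    \<open>k f \<bullet> u = - 1 / D\<close>; the constant \<open>m f\<close> makes it vanish on the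
    hyperplane of \<open>F\<close>.\<close>
  define l where "l f = k f + (1 / D) *\<^sub>R a" for f
  define m where "m f = - (k f \<bullet> p) - b / D" for f
  have lm: "l f \<bullet> x + m f = k f \<bullet> (x - p) + (a \<bullet> x - b) / D" for f x
    by (simp add: l_def m_def inner_add_left inner_diff_right diff_divide_distrib)
  have "facet_chart F a u b l m"
  proof
    show "finite F" "card F = DIM('a)" "\<And>f. f \<in> F \<Longrightarrow> a \<bullet> f = b" "a \<bullet> u = 1"
      using finF card_F a_F au by auto
    show "l f \<bullet> g + m f = of_bool (f = g)" if "f \<in> F" "g \<in> F" for f g
      using that by (simp add: lm kF a_F)
    show "l f \<bullet> u = 0" if "f \<in> F" for f
      using that by (simp add: l_def inner_add_left ku au)
    show "(\<Sum>f\<in>F. l f \<bullet> x + m f) = 1" for x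
      unfolding lm sum.distrib sum_k using D by (simp add: inner_diff_right ap)
    show "x = (\<Sum>f\<in>F. (l f \<bullet> x + m f) *\<^sub>R f) + (a \<bullet> x - b) *\<^sub>R u" for x
    proof -
      have "x - p = (\<Sum>f\<in>F. (k f \<bullet> (x - p)) *\<^sub>R f) - (\<Sum>f\<in>F. k f \<bullet> (x - p)) *\<^sub>R p"
        using rep0[of "x - p"] by (simp add: scaleR_diff_right sum_subtractf scaleR_left.sum)
      then have "x = (\<Sum>f\<in>F. (k f \<bullet> (x - p)) *\<^sub>R f) + (a \<bullet> x - b) *\<^sub>R p"
        unfolding sum_k by (simp add: inner_diff_right ap algebra_simps)
      also have "\<dots> = (\<Sum>f\<in>F. (k f \<bullet> (x - p)) *\<^sub>R f) + (a \<bullet> x - b) *\<^sub>R c + (a \<bullet> x - b) *\<^sub>R u"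
        unfolding p_def scaleR_add_right by (rule add.assoc[symmetric])
      also have "(\<Sum>f\<in>F. (k f \<bullet> (x - p)) *\<^sub>R f) + (a \<bullet> x - b) *\<^sub>R c
          = (\<Sum>f\<in>F. (l f \<bullet> x + m f) *\<^sub>R f)"
        unfolding lm c_def by (simp add: scaleR_add_left sum.distrib scaleR_sum_right)
      finally show ?thesis .
    qed
  qed
  then show ?thesis by blast
qed

context facet_chart
begin

definition "centroid = (1 / real (DIM('a))) *\<^sub>R (\<Sum>f\<in>F. f)"
definition "apex e = centroid + e *\<^sub>R u"
definition "ht x = a \<bullet> x - b"
text \<open>For nonzero \<open>e\<close>, this is the coefficient of \<open>f - apex e\<close> in
  the affine coordinates with origin \<open>apex e\<close>. The apex has barycentric coordinates
  \<open>1 / DIM('a)\<close> and height \<open>e\<close>, which the subtracted term cancels.\<close>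

definition "coord e f x = l f \<bullet> x + m f - ht x / (real (DIM('a)) * e)"
definition "coord_vec e f = l f - (1 / (real (DIM('a)) * e)) *\<^sub>R a"
definition "coord_const e f = m f + b / (real (DIM('a)) * e)"

lemma coord_inner: "coord e f x = coord_vec e f \<bullet> x + coord_const e f"
  by (simp add: coord_def coord_vec_def coord_const_def ht_def inner_diff_left diff_divide_distrib)

lemma ht_F [simp]: "f \<in> F \<Longrightarrow> ht f = 0"
  by (simp add: ht_def a_F)

lemma ht_apex [simp]: "ht (apex e) = e"
  by (simp add: ht_def apex_def centroid_def inner_add_right inner_sum_right a_F a_u card_F)

lemma coord_F: "f \<in> F \<Longrightarrow> g \<in> F \<Longrightarrow> coord e f g = of_bool (f = g)"
  by (simp add: coord_def l_F)

lemma coord_apex: "e \<noteq> 0 \<Longrightarrow> f \<in> F \<Longrightarrow> coord e f (apex e) = 0"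
proof -
  assume e: "e \<noteq> 0" and f: "f \<in> F"
  have "(\<Sum>g\<in>F. l f \<bullet> g + m f) = 1"
    using f finite_F by (simp add: l_F of_bool_def)
  then have "(\<Sum>g\<in>F. l f \<bullet> g) = 1 - real (DIM('a)) * m f"
    by (simp add: sum.distrib card_F)
  then have "l f \<bullet> apex e + m f = 1 / real (DIM('a))"
    using f by (simp add: apex_def centroid_def inner_add_right inner_sum_right l_u field_simps)
  then show ?thesis using e by (simp add: coord_def)
qed

text \<open>Barycentric coordinates sum to one, and each of the \<open>DIM('a)\<close> summands
  loses the same share of the height. Hence the hyperplane of \<open>F\<close> is where the
  coordinates sum to one.\<close>

lemma sum_coord: "e \<noteq> 0 \<Longrightarrow> (\<Sum>f\<in>F. coord e f x) = 1 - ht x / e"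
  by (simp add: coord_def sum_subtractf sum_l card_F)

lemma coord_repr:
  assumes e: "e \<noteq> 0"
  shows "x = apex e + (\<Sum>f\<in>F. coord e f x *\<^sub>R (f - apex e))"
proof -
  have 0: "(\<Sum>f\<in>F. (l f \<bullet> x + m f) *\<^sub>R f) = x - ht x *\<^sub>R u"
    using l_repr[of x, symmetric] by (simp only: ht_def eq_diff_eq)
  have "(\<Sum>f\<in>F. coord e f x *\<^sub>R f) = (\<Sum>f\<in>F. (l f \<bullet> x + m f) *\<^sub>R f) - (ht x / e) *\<^sub>R centroid"
    by (simp add: coord_def centroid_def scaleR_diff_left sum_subtractf scaleR_sum_right mult.commute)
  also have "\<dots> = x - ht x *\<^sub>R u - (ht x / e) *\<^sub>R centroid"
    by (simp only: 0)
  also have "\<dots> = x - (ht x / e) *\<^sub>R apex e"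
    using e by (simp add: apex_def scaleR_add_right)
  finally have 1: "(\<Sum>f\<in>F. coord e f x *\<^sub>R f) = x - (ht x / e) *\<^sub>R apex e" .
  have 2: "(\<Sum>f\<in>F. coord e f x *\<^sub>R apex e) = (1 - ht x / e) *\<^sub>R apex e"
    by (simp only: sum_coord[OF e] flip: scaleR_left.sum)
  show ?thesis
    by (simp add: scaleR_diff_right sum_subtractf 1 2 scaleR_diff_left)
qed

lemma coord_line:
  "e \<noteq> 0 \<Longrightarrow> f \<in> F \<Longrightarrow> g \<in> F \<Longrightarrow> coord e f (apex e + s *\<^sub>R (g - apex e)) = s * of_bool (f = g)"
proof -
  assume *: "e \<noteq> 0" "f \<in> F" "g \<in> F"
  have "coord e f (apex e + s *\<^sub>R (g - apex e)) = (1 - s) * coord e f (apex e) + s * coord e f g"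
    by (simp add: coord_inner inner_add_right inner_diff_right algebra_simps)
  then show ?thesis using * by (simp add: coord_apex coord_F)
qed

end

subsection \<open>Simplices and cross-polytopes over a facet\<close>

context facet_chart
begin

lemma F_nonempty: "F \<noteq> {}"
  using card_F by auto

text \<open>The facet opposite \<open>f\<close> lies in the zero set of \<open>coord e f\<close>,
  and for such a facet the sum over \<open>F - E\<close> merely selects the omitted vertex.
  Completeness holds because nonnegative coordinates with sum at most one are the weights of a
  convex combination, the rest going to the apex.\<close>

lemma facet_system_simplex:
  assumes e: "e > 0"
  shows "facet_system (F \<union> {apex e}) (insert F ((\<lambda>f. insert (apex e) (F - {f})) ` F))
    (\<lambda>E. if E = F then - a else - (\<Sum>f\<in>F - E. coord_vec e f))
    (\<lambda>E. if E = F then - b else (\<Sum>f\<in>F - E. coord_const e f))"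
proof -
  define t where "t = apex e"
  have tF: "t \<notin> F" using ht_F[of t] ht_apex[of e] e t_def by auto
  have e0: "e \<noteq> 0" using e by simp
  have card_t: "card (insert t (F - {f})) = DIM('a)" if "f \<in> F" for f
    using that tF finite_F card_F by (simp add: card_Diff_singleton)
  have indF: "\<not> affine_dependent F"
  proof (rule affine_independent_if_separated)
    fix v assume "v \<in> F"
    then have "l v \<bullet> v \<noteq> - m v" "\<forall>x\<in>F - {v}. l v \<bullet> x = - m v"
      using l_F[of v] by (auto simp: eq_neg_iff_add_eq_0)
    then show "\<exists>p q. p \<bullet> v \<noteq> q \<and> (\<forall>x\<in>F - {v}. p \<bullet> x = q)" by blast
  qed
  have diff: "F - insert t (F - {f}) = {f}" if "f \<in> F" for f using tF that by auto
  have neF: "insert t (F - {f}) \<noteq> F" for f using tF by auto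
  have "facet_system (F \<union> {t}) (insert F ((\<lambda>f. insert t (F - {f})) ` F))
    (\<lambda>E. if E = F then - a else - (\<Sum>f\<in>F - E. coord_vec e f))
    (\<lambda>E. if E = F then - b else (\<Sum>f\<in>F - E. coord_const e f))"
    (is "facet_system _ ?C ?p ?q")
  proof
    show "finite (F \<union> {t})" "?C \<noteq> {}" using finite_F by auto
    show "\<Union> ?C = F \<union> {t}" using F_nonempty by auto
    fix E assume E: "E \<in> ?C"
    show cE: "card E = DIM('a)" using E card_F card_t by auto
    show "E \<noteq> F \<union> {t}" using cE card_F finite_F tF by auto
    show "\<not> affine_dependent E"
    proof (cases "E = F")
      case False
      then obtain f where f: "f \<in> F" "E = insert t (F - {f})" using E by blast
      show ?thesis
      proof (rule affine_independent_if_separated)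
        fix v assume v: "v \<in> E"
        show "\<exists>p q. p \<bullet> v \<noteq> q \<and> (\<forall>x\<in>E - {v}. p \<bullet> x = q)"
        proof (cases "v = t")
          case True
          have "a \<bullet> t \<noteq> b" using ht_apex[of e] e by (simp add: t_def ht_def)
          moreover have "\<forall>x\<in>E - {v}. a \<bullet> x = b" using True f a_F by auto
          ultimately show ?thesis using True by blast
        next
          case False
          then have vF: "v \<in> F" using v f by blast
          have "coord_vec e v \<bullet> v \<noteq> - coord_const e v"
            using coord_F[of v v e] vF by (auto simp: coord_inner eq_neg_iff_add_eq_0)
          moreover have "coord_vec e v \<bullet> x = - coord_const e v" if "x \<in> E - {v}" for x
          proof -
            have "coord e v x = 0"
              using that f vF coord_F[of v x e] coord_apex[OF e0 vF] by (auto simp: t_def)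
            then show ?thesis by (simp add: coord_inner eq_neg_iff_add_eq_0)
          qed
          ultimately show ?thesis by blast
        qed
      qed
    qed (use indF in simp)
    have val: "?p E \<bullet> x - ?q E = - coord e f x" if "f \<in> F" "E = insert t (F - {f})" for f x
      using that by (simp add: neF diff coord_inner)
    show "?p E \<bullet> v = ?q E" if v: "v \<in> E" for v
    proof (cases "E = F")
      case True
      then show ?thesis using v a_F by simp
    next
      case False
      then obtain f where f: "f \<in> F" "E = insert t (F - {f})" using E by blast
      have "coord e f v = 0"
        using v f coord_F[of f v e] coord_apex[OF e0 f(1)] by (auto simp: t_def)
      then show ?thesis using val[OF f, of v] by linarith
    qed
    show "?p E \<bullet> v < ?q E" if v: "v \<in> F \<union> {t}" "v \<notin> E" for v
    proof (cases "E = F")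
      case True
      then show ?thesis using v ht_apex[of e] e by (simp add: ht_def t_def)
    next
      case False
      then obtain f where f: "f \<in> F" "E = insert t (F - {f})" using E by blast
      then have "coord e f v = 1" using v coord_F[of f f e] by auto
      then show ?thesis using val[OF f, of v] by linarith
    qed
  next
    fix x assume x: "\<And>E. E \<in> ?C \<Longrightarrow> ?p E \<bullet> x \<le> ?q E"
    have pos: "0 \<le> coord e f x" if "f \<in> F" for f
      using x[of "insert t (F - {f})"] that by (simp add: neF diff coord_inner)
    have "b \<le> a \<bullet> x" using x[of F] by simp
    then have "(\<Sum>f\<in>F. coord e f x) \<le> 1"
      using e by (simp add: sum_coord ht_def)
    then have "t + (\<Sum>f\<in>F. coord e f x *\<^sub>R (f - t)) \<in> convex hull (F \<union> {t})"
      by (intro convex_add_combination finite_F pos) (auto intro: hull_inc)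
    then show "x \<in> convex hull (F \<union> {t})"
      using coord_repr[OF e0, of x] t_def by simp
  qed
  then show ?thesis by (simp add: t_def)
qed

text \<open>Reflection of \<open>f\<close> in the apex, shrunk by \<open>1 / DIM('a)\<close>. This
  factor keeps the limit for \<open>e\<close> tending to zero in the relative interior of
  \<open>F\<close>.\<close>

definition "antipode e f = apex e - (1 / real (DIM('a))) *\<^sub>R (f - apex e)"

lemma ht_antipode: "f \<in> F \<Longrightarrow> ht (antipode e f) = e * (1 + 1 / real (DIM('a)))"
proof -
  assume f: "f \<in> F"
  have "a \<bullet> apex e = b + e" using ht_apex[of e] by (simp add: ht_def)
  then show ?thesis using f
    by (simp add: antipode_def ht_def inner_diff_right a_F algebra_simps add_divide_distrib)
qed

lemma coord_antipode:
  "e \<noteq> 0 \<Longrightarrow> f \<in> F \<Longrightarrow> g \<in> F \<Longrightarrow> coord e f (antipode e g) = - of_bool (f = g) / real (DIM('a))"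
  using coord_line[of e f g "- 1 / real (DIM('a))"] by (simp add: antipode_def)

lemma antipode_notin: "e > 0 \<Longrightarrow> f \<in> F \<Longrightarrow> antipode e f \<notin> F"
proof
  assume *: "e > 0" "f \<in> F" "antipode e f \<in> F"
  have "0 < e * (1 + 1 / real (DIM('a)))" using * by (intro mult_pos_pos add_pos_pos) auto
  then show False using * ht_antipode[of f e] ht_F[of "antipode e f"] by simp
qed

lemma inj_on_antipode: "e \<noteq> 0 \<Longrightarrow> inj_on (antipode e) F"
proof (rule inj_onI)
  fix f g assume *: "e \<noteq> 0" "f \<in> F" "g \<in> F" "antipode e f = antipode e g"
  then show "f = g"
    using coord_antipode[of e f f] coord_antipode[of e f g] by (auto split: if_splits)
qed

text \<open>For \<open>I \<subseteq> F\<close> and \<open>e\<close> nonzero this is one on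
  \<open>I\<close> and on the antipodes of \<open>F - I\<close>, so it defines that facet of the
  cross-polytope. The factor \<open>DIM('a)\<close> undoes the shrinking of the antipodes.\<close>

definition "cross e I x = (\<Sum>f\<in>I. coord e f x) - real (DIM('a)) * (\<Sum>f\<in>F - I. coord e f x)"

lemma cross_F: "I \<subseteq> F \<Longrightarrow> g \<in> F \<Longrightarrow> cross e I g = (if g \<in> I then 1 else - real (DIM('a)))"
proof -
  assume *: "I \<subseteq> F" "g \<in> F"
  have fin: "finite I" "finite (F - I)" using * finite_F finite_subset by auto
  have "(\<Sum>f\<in>I. coord e f g) = (\<Sum>f\<in>I. of_bool (f = g))"
    using * by (intro sum.cong) (auto simp: coord_F)
  moreover have "(\<Sum>f\<in>F - I. coord e f g) = (\<Sum>f\<in>F - I. of_bool (f = g))"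
    using * by (intro sum.cong) (auto simp: coord_F)
  ultimately show ?thesis using * fin by (simp add: cross_def of_bool_def)
qed

lemma cross_antipode:
  assumes "e \<noteq> 0" "I \<subseteq> F" "g \<in> F"
  shows "cross e I (antipode e g) = (if g \<in> I then - 1 / real (DIM('a)) else 1)"
proof -
  have fin: "finite I" "finite (F - I)" using assms finite_F finite_subset by auto
  have "(\<Sum>f\<in>I. coord e f (antipode e g)) = (\<Sum>f\<in>I. if f = g then - 1 / real (DIM('a)) else 0)"
    using assms by (intro sum.cong) (auto simp: coord_antipode)
  moreover have "(\<Sum>f\<in>F - I. coord e f (antipode e g)) = (\<Sum>f\<in>F - I. if f = g then - 1 / real (DIM('a)) else 0)"
    using assms by (intro sum.cong) (auto simp: coord_antipode)
  ultimately show ?thesis using assms fin by (simp add: cross_def)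
qed

text \<open>Functionals are indexed by the facet \<open>E\<close>, so \<open>I\<close> is recovered
  as \<open>F \<inter> E\<close>.\<close>

definition "cross_vec e E =
  (\<Sum>f\<in>F \<inter> E. coord_vec e f) - real (DIM('a)) *\<^sub>R (\<Sum>f\<in>F - E. coord_vec e f)"
definition "cross_const e E =
  1 - (\<Sum>f\<in>F \<inter> E. coord_const e f) + real (DIM('a)) * (\<Sum>f\<in>F - E. coord_const e f)"

lemma cross_inner: "cross_vec e E \<bullet> x - cross_const e E = cross e (F \<inter> E) x - 1"
proof -
  have "F - F \<inter> E = F - E" by blast
  then show ?thesis
    by (simp add: cross_def cross_vec_def cross_const_def coord_inner sum.distrib
        inner_diff_left inner_sum_left algebra_simps)
qed

text \<open>A facet picks one point of each antipodal pair. Completeness needs only the inequality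
  for the set \<open>I\<close> of nonnegative coordinates of \<open>x\<close>: it bounds the total
  weight with which the picked points represent \<open>x\<close> relative to the apex.\<close>

lemma facet_system_cross_polytope:
  assumes e: "e > 0"
  shows "facet_system (F \<union> antipode e ` F) ((\<lambda>I. I \<union> antipode e ` (F - I)) ` Pow F)
    (cross_vec e) (cross_const e)"
    (is "facet_system ?V ?C ?p ?q")
proof -
  define w where "w = antipode e"
  have wF: "w f \<notin> F" if "f \<in> F" for f using antipode_notin[OF e that] by (simp add: w_def)
  have e0: "e \<noteq> 0" using e by simp
  have winj: "inj_on w F" using inj_on_antipode[OF e0] w_def by simp
  have IE: "F \<inter> (I \<union> w ` (F - I)) = I" if "I \<subseteq> F" for I
    using that wF by auto
  have val: "?p E \<bullet> x - ?q E = cross e I x - 1" if "I \<subseteq> F" "E = I \<union> w ` (F - I)" for I E x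
    using cross_inner[of e E x] IE[OF that(1)] that(2) by simp
  have "facet_system (F \<union> w ` F) ((\<lambda>I. I \<union> w ` (F - I)) ` Pow F) ?p ?q"
    (is "facet_system _ ?C' _ _")
  proof
    show "finite (F \<union> w ` F)" "?C' \<noteq> {}" using finite_F by auto
    show "\<Union> ?C' = F \<union> w ` F" by auto
    fix E assume "E \<in> ?C'"
    then obtain I where I: "I \<subseteq> F" "E = I \<union> w ` (F - I)" by blast
    define h where "h f = (if f \<in> I then f else w f)" for f
    have Eh: "E = h ` F" using I by (auto simp: h_def)
    have hinj: "inj_on h F"
      using winj wF unfolding h_def inj_on_def by (metis (full_types))
    show "card E = DIM('a)" unfolding Eh using card_image[OF hinj] card_F by simp
    have "card (F \<union> w ` F) = card F + card F"
      using wF finite_F card_image[OF winj] by (subst card_Un_disjoint) auto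
    then show "E \<noteq> F \<union> w ` F" using \<open>card E = DIM('a)\<close> card_F by auto
    show "\<not> affine_dependent E"
    proof (rule affine_independent_if_separated)
      fix v assume "v \<in> E"
      then obtain f where f: "f \<in> F" "v = h f" using Eh by blast
      have c: "coord e f (h g) = (if f = g then (if f \<in> I then 1 else - 1 / real (DIM('a))) else 0)" if "g \<in> F" for g
        using that f coord_F[of f g e] coord_antipode[OF e0, of f g] by (auto simp: h_def w_def)
      have "coord_vec e f \<bullet> v \<noteq> - coord_const e f"
        using c[OF f(1)] f by (auto simp: coord_inner eq_neg_iff_add_eq_0 split: if_splits)
      moreover have "coord_vec e f \<bullet> x = - coord_const e f" if x: "x \<in> E - {v}" for x
      proof -
        obtain g where g: "g \<in> F" "x = h g" using x Eh by blast
        then have "coord e f x = 0" using c[OF g(1)] x f by auto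
        then show ?thesis by (simp add: coord_inner eq_neg_iff_add_eq_0)
      qed
      ultimately show "\<exists>p q. p \<bullet> v \<noteq> q \<and> (\<forall>x\<in>E - {v}. p \<bullet> x = q)" by blast
    qed
    show "?p E \<bullet> v = ?q E" if v: "v \<in> E" for v
    proof -
      have "cross e I v = 1"
        using v I cross_F[OF I(1), of v e] cross_antipode[OF e0 I(1)] by (auto simp: w_def)
      then show ?thesis using val[OF I, of v] by linarith
    qed
    show "?p E \<bullet> v < ?q E" if v: "v \<in> F \<union> w ` F" "v \<notin> E" for v
    proof -
      have "cross e I v < 1"
      proof (cases "v \<in> F")
        case True
        then have "v \<notin> I" using v I by auto
        then have "cross e I v = - real (DIM('a))" using cross_F[OF I(1) True] by simp
        also have "\<dots> < 1" by (smt (verit) of_nat_0_le_iff)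
        finally show ?thesis .
      next
        case False
        then obtain g where g: "g \<in> F" "v = w g" using v by blast
        then have "g \<in> I" using v I by auto
        then have "cross e I v = - 1 / real (DIM('a))"
          using cross_antipode[OF e0 I(1) g(1)] g by (simp add: w_def)
        then show ?thesis by (smt (verit) divide_nonpos_nonneg of_nat_0_le_iff)
      qed
      then show ?thesis using val[OF I, of v] by linarith
    qed
  next
    fix x assume x: "\<And>E. E \<in> ?C' \<Longrightarrow> ?p E \<bullet> x \<le> ?q E"
    let ?D = "real (DIM('a))"
    define I where "I = {f \<in> F. 0 \<le> coord e f x}"
    have IF: "I \<subseteq> F" by (auto simp: I_def)
    have "?p (I \<union> w ` (F - I)) \<bullet> x \<le> ?q (I \<union> w ` (F - I))"
      by (rule x) (use IF in auto)
    then have le: "cross e I x \<le> 1" using val[OF IF refl, of x] by linarith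
    \<comment> \<open>At a negative coordinate the antipode replaces \<open>f\<close>. Its vector
      from the apex is \<open>- 1 / ?D\<close> times that of \<open>f\<close>, hence the factor
      \<open>- ?D\<close>.\<close>
    define c where "c f = (if f \<in> I then coord e f x else - ?D * coord e f x)" for f
    define z where "z f = (if f \<in> I then f else w f)" for f
    have sum_c: "sum c F = cross e I x"
    proof -
      have "sum c F = sum c I + sum c (F - I)"
        using sum.subset_diff[OF IF finite_F, of c] by simp
      also have "sum c I = (\<Sum>f\<in>I. coord e f x)" by (intro sum.cong) (auto simp: c_def)
      also have "sum c (F - I) = - ?D * (\<Sum>f\<in>F - I. coord e f x)"
        unfolding sum_distrib_left by (intro sum.cong) (auto simp: c_def)
      finally show ?thesis by (simp add: cross_def)
    qed
    obtain f where f: "f \<in> F" using F_nonempty by blast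
    \<comment> \<open>The apex divides the segment from \<open>f\<close> to its antipode, so it lies
      in the hull and can take the leftover weight.\<close>
    have "apex e = (1 / (?D + 1)) *\<^sub>R f + (?D / (?D + 1)) *\<^sub>R w f"
    proof -
      have "(?D + 1) *\<^sub>R apex e = f + ?D *\<^sub>R w f"
        by (simp add: w_def antipode_def algebra_simps)
      then have "(1 / (?D + 1)) *\<^sub>R ((?D + 1) *\<^sub>R apex e) = (1 / (?D + 1)) *\<^sub>R (f + ?D *\<^sub>R w f)" by simp
      moreover have "?D + 1 \<noteq> 0" by (smt (verit) of_nat_0_le_iff)
      ultimately show ?thesis by (simp add: scaleR_add_right)
    qed
    moreover have "(1 / (?D + 1)) *\<^sub>R f + (?D / (?D + 1)) *\<^sub>R w f \<in> convex hull (F \<union> w ` F)"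
      by (rule convexD[OF convex_convex_hull])
        (use f in \<open>auto intro: hull_inc simp: field_simps add_nonneg_eq_0_iff\<close>)
    ultimately have apex_in: "apex e \<in> convex hull (F \<union> w ` F)" by simp
    have "apex e + (\<Sum>f\<in>F. c f *\<^sub>R (z f - apex e)) \<in> convex hull (F \<union> w ` F)"
    proof (rule convex_add_combination[OF convex_convex_hull apex_in finite_F])
      show "0 \<le> c f" if "f \<in> F" for f
        using that by (auto simp: c_def I_def mult_nonneg_nonpos)
      show "sum c F \<le> 1" using sum_c le by simp
      show "z f \<in> convex hull (F \<union> w ` F)" if "f \<in> F" for f
        using that by (auto simp: z_def intro: hull_inc)
    qed
    moreover have "c f *\<^sub>R (z f - apex e) = coord e f x *\<^sub>R (f - apex e)" for f
      by (simp add: c_def z_def w_def antipode_def)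
    ultimately show "x \<in> convex hull (F \<union> w ` F)"
      using coord_repr[OF e0, of x] by simp
  qed
  then show ?thesis by (simp add: w_def)
qed

end

section \<open>Gluing flat simplices and cross-polytopes onto a facet\<close>

context facet_system
begin

lemma facet_chart_facet:
  assumes F: "F \<in> \<E>"
  shows "\<exists>u l m. facet_chart F (a F) u (b F) l m"
proof (rule facet_chart_exists[OF indep[OF F] card_facet[OF F] on[OF F]])
  obtain v where v: "v \<in> V" "v \<notin> F" using facet_subset[OF F] proper[OF F] by blast
  have "F \<noteq> {}" using card_facet[OF F] by auto
  then obtain f where "f \<in> F" by blast
  then show "a F \<noteq> 0" using on[OF F, of f] below[OF F v] by auto
qed

text \<open>A flat simplex is glued onto \<open>F\<close>. As \<open>e\<close> tends to zero, its
  apex tends to the centroid, strictly below the other hyperplanes, while the coordinates of an old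
  vertex off \<open>F\<close> tend to infinity. Dimension at least two keeps every vertex of
  \<open>F\<close> on a new facet.\<close>

lemma facet_system_stack:
  assumes F: "F \<in> \<E>" and D: "DIM('a) \<ge> 2"
  shows "\<exists>t a' b'. t \<notin> V \<and>
    facet_system (insert t V) ((\<E> - {F}) \<union> (\<lambda>f. insert t (F - {f})) ` F) a' b'"
proof -
  obtain u l m where "facet_chart F (a F) u (b F) l m" using facet_chart_facet[OF F] by blast
  then interpret C: facet_chart F "a F" u "b F" l m .
  let ?D = "real (DIM('a))"
  have "\<forall>\<^sub>F e in at_right 0. \<forall>E\<in>\<E> - {F}. a E \<bullet> C.apex e < b E"
  proof (intro eventually_ball_finite ballI)
    fix E assume E: "E \<in> \<E> - {F}"
    have "a E \<bullet> (\<Sum>f\<in>F. (1 / ?D) *\<^sub>R f) < b E"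
      using E F C.card_F by (intro positive_combination_below) auto
    then have "a E \<bullet> C.centroid < b E" by (simp add: C.centroid_def scaleR_sum_right)
    from eventually_at_right_0_linear_less[OF this, of "a E \<bullet> u"]
    show "\<forall>\<^sub>F e in at_right 0. a E \<bullet> C.apex e < b E"
      by (simp add: C.apex_def inner_add_right)
  qed (use finite_facets in auto)
  moreover have "\<forall>\<^sub>F e in at_right 0. \<forall>v\<in>V - F. \<forall>f\<in>F. 0 < C.coord e f v"
  proof (intro eventually_ball_finite ballI)
    fix v f assume v: "v \<in> V - F" and f: "f \<in> F"
    have "C.ht v / ?D < 0" using below[OF F, of v] v by (simp add: C.ht_def divide_less_0_iff)
    from eventually_at_right_0_inverse_less[OF this, of "- (l f \<bullet> v + m f)" 0]
    show "\<forall>\<^sub>F e in at_right 0. 0 < C.coord e f v"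
      by (simp add: C.coord_def algebra_simps)
  qed (use finite_V C.finite_F in auto)
  moreover have "\<forall>\<^sub>F e in at_right (0::real). 0 < e" by (simp add: eventually_at_right_less)
  ultimately have "\<forall>\<^sub>F e in at_right 0. 0 < e \<and> (\<forall>E\<in>\<E> - {F}. a E \<bullet> C.apex e < b E) \<and>
      (\<forall>v\<in>V - F. \<forall>f\<in>F. 0 < C.coord e f v)"
    by eventually_elim blast
  from eventually_happens'[OF trivial_limit_at_right_real this]
  obtain e where e: "e > 0" and e1: "\<And>E. E \<in> \<E> - {F} \<Longrightarrow> a E \<bullet> C.apex e < b E"
    and e2: "\<And>v f. v \<in> V - F \<Longrightarrow> f \<in> F \<Longrightarrow> 0 < C.coord e f v"
    by metis
  define t where "t = C.apex e"
  have "a F \<bullet> t = b F + e" using C.ht_apex[of e] by (simp add: C.ht_def t_def)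
  then have tV: "t \<notin> V" using hull_le[OF F hull_inc, of t] e by auto
  then have tF: "t \<notin> F" using facet_subset[OF F] by blast
  have C_minus: "insert F ((\<lambda>f. insert t (F - {f})) ` F) - {F} = (\<lambda>f. insert t (F - {f})) ` F"
    using tF by auto
  have "\<exists>a' b'. facet_system (V \<union> {t})
      ((\<E> - {F}) \<union> (insert F ((\<lambda>f. insert t (F - {f})) ` F) - {F})) a' b'"
  proof (rule facet_system_glue[OF facet_system_axioms C.facet_system_simplex[OF e, folded t_def] F])
    show "F \<in> insert F ((\<lambda>f. insert t (F - {f})) ` F)" "{t} \<inter> V = {}" "{t} \<noteq> {}"
      using tV by auto
    show "a E \<bullet> w < b E" if "E \<in> \<E> - {F}" "w \<in> {t}" for E w
      using e1 that by (simp add: t_def)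
    show "F \<subseteq> \<Union> (insert F ((\<lambda>f. insert t (F - {f})) ` F) - {F})"
      unfolding C_minus
    proof
      fix f assume f: "f \<in> F"
      have "\<not> F \<subseteq> {f}" using card_mono[of "{f}" F] C.card_F D by auto
      then obtain g where "g \<in> F" "g \<noteq> f" by blast
      then show "f \<in> \<Union> ((\<lambda>f. insert t (F - {f})) ` F)" using f by auto
    qed
    show "(if E = F then - a F else - (\<Sum>f\<in>F - E. C.coord_vec e f)) \<bullet> v
        < (if E = F then - b F else (\<Sum>f\<in>F - E. C.coord_const e f))"
      if E: "E \<in> insert F ((\<lambda>f. insert t (F - {f})) ` F) - {F}" and v: "v \<in> V - F" for E v
    proof -
      obtain f where f: "f \<in> F" "E = insert t (F - {f})" using E unfolding C_minus by blast
      then have "F - E = {f}" "E \<noteq> F" using tF by auto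
      then show ?thesis using e2[OF v f(1)] by (simp add: C.coord_inner)
    qed
  qed auto
  then show ?thesis using tV unfolding C_minus by auto
qed

text \<open>The two limits are as for stacking: the antipodes tend to relative interior points of
  \<open>F\<close>, and each functional \<open>cross\<close> other than that of \<open>F\<close>
  tends to minus infinity at old vertices off \<open>F\<close>. The subset \<open>I = F\<close> is
  left out because it gives the glued facet itself.\<close>

lemma facet_system_cross:
  assumes F: "F \<in> \<E>" and D: "DIM('a) \<ge> 2"
  shows "\<exists>w a' b'. inj_on w F \<and> w ` F \<inter> V = {} \<and>
    facet_system (V \<union> w ` F) ((\<E> - {F}) \<union> (\<lambda>I. I \<union> w ` (F - I)) ` (Pow F - {F})) a' b'"
proof -
  obtain u l m where "facet_chart F (a F) u (b F) l m" using facet_chart_facet[OF F] by blast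
  then interpret C: facet_chart F "a F" u "b F" l m .
  let ?D = "real (DIM('a))"
  have D0: "?D > 0" by simp
  have "\<forall>\<^sub>F e in at_right 0. \<forall>E\<in>\<E> - {F}. \<forall>f\<in>F. a E \<bullet> C.antipode e f < b E"
  proof (intro eventually_ball_finite ballI)
    fix E f assume E: "E \<in> \<E> - {F}" and f: "f \<in> F"
    \<comment> \<open>Barycentric weights of the flat limit of the antipode of \<open>f\<close>. The
      smallest one, at \<open>f\<close> itself, is \<open>1 / (?D * ?D)\<close>.\<close>
    define \<mu> where "\<mu> g = (1 + 1 / ?D) / ?D - of_bool (g = f) / ?D" for g
    have "a E \<bullet> (\<Sum>g\<in>F. \<mu> g *\<^sub>R g) < b E"
    proof (intro positive_combination_below)
      show "0 < \<mu> g" for g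
        by (cases "g = f") (auto simp: \<mu>_def add_divide_distrib add_pos_pos)
      show "sum \<mu> F = 1"
        using f C.finite_F D0
        by (simp add: \<mu>_def sum_subtractf C.card_F of_bool_def flip: sum_divide_distrib)
    qed (use E F in auto)
    moreover have "(\<Sum>g\<in>F. \<mu> g *\<^sub>R g) = (1 + 1 / ?D) *\<^sub>R C.centroid - (1 / ?D) *\<^sub>R f"
    proof -
      have "(\<Sum>g\<in>F. (of_bool (g = f) / ?D) *\<^sub>R g) = (\<Sum>g\<in>F. if g = f then (1 / ?D) *\<^sub>R g else 0)"
        by (intro sum.cong) auto
      then show ?thesis using f C.finite_F
        by (simp add: \<mu>_def C.centroid_def scaleR_diff_left sum_subtractf scaleR_sum_right)
    qed
    ultimately have "a E \<bullet> ((1 + 1 / ?D) *\<^sub>R C.centroid - (1 / ?D) *\<^sub>R f) < b E" by simp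
    from eventually_at_right_0_linear_less[OF this, of "(1 + 1 / ?D) * (a E \<bullet> u)"]
    show "\<forall>\<^sub>F e in at_right 0. a E \<bullet> C.antipode e f < b E"
    proof eventually_elim
      case (elim e)
      have "C.antipode e f = (1 + 1 / ?D) *\<^sub>R C.centroid - (1 / ?D) *\<^sub>R f + e *\<^sub>R (1 + 1 / ?D) *\<^sub>R u"
        by (simp add: C.antipode_def C.apex_def algebra_simps)
      then show ?case using elim by (simp add: inner_add_right)
    qed
  qed (use finite_facets C.finite_F in auto)
  moreover have "\<forall>\<^sub>F e in at_right 0. \<forall>v\<in>V - F. \<forall>I\<in>Pow F - {F}. C.cross e I v < 1"
  proof (intro eventually_ball_finite ballI)
    fix v I assume v: "v \<in> V - F" and I: "I \<in> Pow F - {F}"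
    \<comment> \<open>The coefficient of \<open>C.ht v / (?D * e)\<close> in
      \<open>C.cross e I v\<close>. It is positive since \<open>I\<close> omits a vertex of
      \<open>F\<close>, which contributes \<open>?D\<close>, more than
      \<open>card I\<close>.\<close>
    define s where "s = ?D * real (card (F - I)) - real (card I)"
    have finI: "finite I" using I C.finite_F finite_subset by auto
    have lt: "card I < card F" using I C.finite_F by (intro psubset_card_mono) auto
    then have "card (F - I) \<ge> 1" using I finI by (simp add: card_Diff_subset)
    then have "?D * 1 \<le> ?D * real (card (F - I))" by (intro mult_left_mono) auto
    moreover have "real (card I) < ?D" using lt C.card_F by simp
    ultimately have s: "s > 0" unfolding s_def by linarith
    have "C.ht v < 0" using below[OF F, of v] v by (simp add: C.ht_def)
    then have "C.ht v * s / ?D < 0" using s by (simp add: divide_less_0_iff mult_less_0_iff)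
    from eventually_at_right_0_inverse_less[OF this,
        of "(\<Sum>f\<in>I. l f \<bullet> v + m f) - ?D * (\<Sum>f\<in>F - I. l f \<bullet> v + m f)" 1]
    show "\<forall>\<^sub>F e in at_right 0. C.cross e I v < 1"
    proof eventually_elim
      case (elim e)
      have "C.cross e I v = (\<Sum>f\<in>I. l f \<bullet> v + m f) - ?D * (\<Sum>f\<in>F - I. l f \<bullet> v + m f)
          + (?D * real (card (F - I)) - real (card I)) * (C.ht v / (?D * e))"
        by (simp add: C.cross_def C.coord_def sum_subtractf algebra_simps)
      then show ?case using elim by (simp add: s_def mult.commute)
    qed
  qed (use finite_V C.finite_F in auto)
  moreover have "\<forall>\<^sub>F e in at_right (0::real). 0 < e" by (simp add: eventually_at_right_less)
  ultimately have "\<forall>\<^sub>F e in at_right 0. 0 < e \<and> (\<forall>E\<in>\<E> - {F}. \<forall>f\<in>F. a E \<bullet> C.antipode e f < b E) \<and>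
      (\<forall>v\<in>V - F. \<forall>I\<in>Pow F - {F}. C.cross e I v < 1)"
    by eventually_elim blast
  from eventually_happens'[OF trivial_limit_at_right_real this]
  obtain e where e: "e > 0"
    and e1: "\<And>E f. E \<in> \<E> - {F} \<Longrightarrow> f \<in> F \<Longrightarrow> a E \<bullet> C.antipode e f < b E"
    and e2: "\<And>v I. v \<in> V - F \<Longrightarrow> I \<in> Pow F - {F} \<Longrightarrow> C.cross e I v < 1"
    by metis
  have e0: "e \<noteq> 0" using e by simp
  define w where "w = C.antipode e"
  have wV: "w f \<notin> V" if "f \<in> F" for f
  proof
    assume "w f \<in> V"
    then have "C.ht (w f) \<le> 0" using hull_le[OF F hull_inc, of "w f"] by (simp add: C.ht_def)
    moreover have "C.ht (w f) > 0"
      unfolding w_def C.ht_antipode[OF that] using e by (intro mult_pos_pos add_pos_pos) auto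
    ultimately show False by simp
  qed
  have wF: "w f \<notin> F" if "f \<in> F" for f using wV[OF that] facet_subset[OF F] by blast
  have IE: "F \<inter> (I \<union> w ` (F - I)) = I" if "I \<subseteq> F" for I using that wF by auto
  let ?C = "(\<lambda>I. I \<union> w ` (F - I)) ` Pow F"
  have C_minus: "?C - {F} = (\<lambda>I. I \<union> w ` (F - I)) ` (Pow F - {F})"
    using wF by auto
  have "\<exists>a' b'. facet_system (V \<union> w ` F) ((\<E> - {F}) \<union> (?C - {F})) a' b'"
  proof (rule facet_system_glue[OF facet_system_axioms C.facet_system_cross_polytope[OF e, folded w_def] F])
    show "F \<in> ?C" by (rule image_eqI[of _ _ F]) auto
    show "w ` F \<inter> V = {}" "w ` F \<noteq> {}" using wV C.F_nonempty by auto
    show "a E \<bullet> x < b E" if "E \<in> \<E> - {F}" "x \<in> w ` F" for E x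
      using e1 that by (auto simp: w_def)
    \<comment> \<open>For \<open>I = F\<close> the functional is one minus the scaled height, so
      this facet faces the old polytope.\<close>
    show "C.cross_vec e F \<bullet> x \<le> C.cross_const e F" if "b F \<le> a F \<bullet> x" for x
    proof -
      have "C.cross e F x = 1 - C.ht x / e" by (simp add: C.cross_def C.sum_coord[OF e0])
      moreover have "0 \<le> C.ht x / e" using that e by (simp add: C.ht_def)
      ultimately show ?thesis using C.cross_inner[of e F x] by simp
    qed
    show "C.cross_vec e E \<bullet> v < C.cross_const e E" if E: "E \<in> ?C - {F}" and v: "v \<in> V - F" for E v
    proof -
      obtain I where I: "I \<in> Pow F - {F}" "E = I \<union> w ` (F - I)" using E unfolding C_minus by blast
      then show ?thesis using e2[OF v I(1)] C.cross_inner[of e E v] IE[of I] by simp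
    qed
    show "F \<subseteq> \<Union> (?C - {F})"
      unfolding C_minus
    proof
      fix f assume f: "f \<in> F"
      have "F \<noteq> {f}" using C.card_F D by auto
      then have "{f} \<in> Pow F - {F}" using f by auto
      then show "f \<in> \<Union> ((\<lambda>I. I \<union> w ` (F - I)) ` (Pow F - {F}))" by blast
    qed
  qed
  moreover have "inj_on w F" using C.inj_on_antipode[OF e0] w_def by simp
  moreover have "w ` F \<inter> V = {}" using wV by auto
  ultimately show ?thesis unfolding C_minus by blast
qed

end

subsection \<open>Transversals\<close>

text \<open>Among the cross-polytope facets, those with exactly one vertex in \<open>F\<close> or
  exactly one antipode suffice. \<open>lower_F\<close> records the extra cost of containing the
  glued facet; the second conclusion restores this property, with \<open>k + 2\<close> for
  \<open>k\<close>, for a stacked facet through \<open>t\<close>.\<close>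

lemma transversal_card_step:
  assumes finV: "finite V" and sub: "\<And>E. E \<in> \<E> \<Longrightarrow> E \<subseteq> V" and F: "F \<in> \<E>" "3 \<le> card F"
    and w: "inj_on w F" "w ` F \<inter> V = {}" and t: "t \<notin> V" "t \<notin> w ` F"
    and lower: "\<And>T. T \<subseteq> V \<Longrightarrow> \<forall>E\<in>\<E>. T \<inter> E \<noteq> {} \<Longrightarrow> k \<le> card T"
    and lower_F: "\<And>T. T \<subseteq> V \<Longrightarrow> \<forall>E\<in>\<E>. T \<inter> E \<noteq> {} \<Longrightarrow> F \<subseteq> T \<Longrightarrow> k + 1 \<le> card T"
    and T: "T \<subseteq> insert t (V \<union> w ` F)"
    and old: "\<And>E. E \<in> \<E> \<Longrightarrow> E \<noteq> F \<Longrightarrow> T \<inter> E \<noteq> {}"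
    and one_F: "\<And>f. f \<in> F \<Longrightarrow> T \<inter> insert f (w ` (F - {f})) \<noteq> {}"
    and one_w: "\<And>f. f \<in> F \<Longrightarrow> T \<inter> insert (w f) (F - {f}) \<noteq> {}"
    and top: "\<And>f. f \<in> F \<Longrightarrow> T \<inter> insert t (w ` (F - {f})) \<noteq> {}"
  shows "k + 2 \<le> card T"
    and "c \<in> F \<Longrightarrow> insert t (w ` (F - {c})) \<subseteq> T \<Longrightarrow> k + 3 \<le> card T"
proof -
  have FV: "F \<subseteq> V" using sub F by blast
  have finF: "finite F" using FV finV finite_subset by blast
  have Fne: "F \<noteq> {}" using F by auto
  define A where "A = T \<inter> V"
  define B where "B = T \<inter> insert t (w ` F)"
  have finAB: "finite A" "finite B" using finV finF by (auto simp: A_def B_def)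
  have "T = A \<union> B" "A \<inter> B = {}" using T w t by (auto simp: A_def B_def)
  then have cardT: "card T = card A + card B" using card_Un_disjoint finAB by metis
  have AV: "A \<subseteq> V" by (auto simp: A_def)
  have A_old: "A \<inter> E \<noteq> {}" if "E \<in> \<E>" "E \<noteq> F" for E
    using old[OF that] sub[OF that(1)] by (auto simp: A_def)
  have meets: "k \<le> card A" if "A \<inter> F \<noteq> {}"
    using lower[OF AV] A_old that by blast
  \<comment> \<open>One vertex of \<open>F\<close> added to \<open>A\<close> gives an old
    transversal. A facet whose only antipode is \<open>w g\<close> must be hit at
    \<open>w g\<close>, its other vertices being in \<open>F\<close>.\<close>
  have misses: "k \<le> card A + 1" "w ` F \<subseteq> B" if no: "A \<inter> F = {}"
  proof -
    obtain f where f: "f \<in> F" using Fne by blast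
    have "k \<le> card (insert f A)"
    proof (rule lower)
      show "insert f A \<subseteq> V" using AV f FV by blast
      show "\<forall>E\<in>\<E>. insert f A \<inter> E \<noteq> {}" using A_old f by blast
    qed
    then show "k \<le> card A + 1" using finAB(1) by (simp add: card_insert_if split: if_splits)
    show "w ` F \<subseteq> B"
    proof
      fix x assume "x \<in> w ` F"
      then obtain g where g: "g \<in> F" "x = w g" by blast
      have "T \<inter> F = {}" using no FV by (auto simp: A_def)
      then have "w g \<in> T" using one_w[OF g(1)] by blast
      then show "x \<in> B" using g by (auto simp: B_def)
    qed
  qed
  have cardw: "card (w ` F) = card F" using card_image[OF w(1)] .
  show "k + 2 \<le> card T"
  proof (cases "B \<inter> w ` F = {}")
    case True
    then have Tw: "T \<inter> w ` F = {}" by (auto simp: B_def)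
    \<comment> \<open>With no antipode in \<open>T\<close>, the facet through \<open>f\<close> and
      the antipodes of the other vertices can only be hit at \<open>f\<close>.\<close>
    have FA: "F \<subseteq> A"
    proof
      fix f assume f: "f \<in> F"
      have "w ` (F - {f}) \<subseteq> w ` F" by blast
      then have "f \<in> T" using one_F[OF f] Tw by blast
      then show "f \<in> A" using f FV by (auto simp: A_def)
    qed
    then have "A \<inter> F \<noteq> {}" using Fne by blast
    then have "k + 1 \<le> card A" using lower_F[OF AV _ FA] A_old by blast
    moreover have "card B \<ge> 1"
    proof -
      obtain f where f: "f \<in> F" using Fne by blast
      have "B \<noteq> {}" using top[OF f] by (auto simp: B_def)
      then show ?thesis using finAB(2) by (simp add: Suc_le_eq card_gt_0_iff)
    qed
    ultimately show ?thesis using cardT by simp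
  next
    case False
    then obtain f where f: "f \<in> F" "w f \<in> B" by blast
    \<comment> \<open>The stacked facet that omits \<open>w f\<close> forces a second new
      vertex.\<close>
    then obtain y where y: "y \<in> T" "y \<in> insert t (w ` (F - {f}))" using top[OF f(1)] by blast
    have "y \<noteq> w f" using y(2) f(1) t w(1) by (auto simp: inj_on_def)
    moreover have "y \<in> B" using y by (auto simp: B_def)
    ultimately have "card {w f, y} = 2" "{w f, y} \<subseteq> B" using f by auto
    then have B2: "2 \<le> card B" using card_mono[OF finAB(2)] by metis
    show ?thesis
    proof (cases "A \<inter> F = {}")
      case True
      then have "card F \<le> card B" using misses(2) cardw card_mono[OF finAB(2)] by metis
      then show ?thesis using misses(1)[OF True] F(2) cardT by simp
    next
      case False
      then show ?thesis using meets B2 cardT by simp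
    qed
  qed
  show "k + 3 \<le> card T" if c: "c \<in> F" and new: "insert t (w ` (F - {c})) \<subseteq> T"
  proof (cases "A \<inter> F = {}")
    case True
    have "insert t (w ` F) \<subseteq> B" using misses(2)[OF True] new by (auto simp: B_def)
    then have "card (insert t (w ` F)) \<le> card B" using card_mono[OF finAB(2)] by blast
    \<comment> \<open>At least three antipodes and \<open>t\<close>: the fourth makes up for the one
      by which \<open>A\<close> may fall short of \<open>k\<close>.\<close>
    then have "4 \<le> card B" using t finF cardw F(2) by simp
    then show ?thesis using misses(1)[OF True] cardT by simp
  next
    case False
    have "insert t (w ` (F - {c})) \<subseteq> B" using new by (auto simp: B_def)
    then have "card (insert t (w ` (F - {c}))) \<le> card B" using card_mono[OF finAB(2)] by blast
    moreover have "t \<notin> w ` (F - {c})" using t by blast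
    moreover have "card (w ` (F - {c})) = card F - 1"
      using card_image[OF inj_on_subset[OF w(1)], of "F - {c}"] c finF by (simp add: card_Diff_singleton)
    ultimately have "3 \<le> card B" using finF F(2) by simp
    then show ?thesis using meets[OF False] cardT by simp
  qed
qed

text \<open>The induction invariant, with \<open>F\<close> marked for the next gluing. The
  additional \<open>1\<close> for transversals containing \<open>F\<close> feeds the next lower
  bound; two vertices of a minimum transversal in \<open>F\<close> feed the next upper
  bound.\<close>

definition tight_system :: "nat \<Rightarrow> 'a::euclidean_space set \<Rightarrow> 'a set set \<Rightarrow> 'a set \<Rightarrow> bool" where
  "tight_system k V \<E> F \<longleftrightarrow> (\<exists>a b. facet_system V \<E> a b) \<and> card V = k * (DIM('a) + 1) \<and> F \<in> \<E> \<and>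
    (\<forall>T\<subseteq>V. (\<forall>E\<in>\<E>. T \<inter> E \<noteq> {}) \<longrightarrow> 2 * k \<le> card T \<and> (F \<subseteq> T \<longrightarrow> 2 * k + 1 \<le> card T)) \<and>
    (\<exists>T\<subseteq>V. (\<forall>E\<in>\<E>. T \<inter> E \<noteq> {}) \<and> card T = 2 * k \<and> 2 \<le> card (T \<inter> F))"

text \<open>The next marked facet is a stacked one that contains both antipodes added to the minimum
  transversal. It omits the antipode of a third vertex \<open>c\<close> of \<open>F\<close>,
  available in dimension at least three.\<close>

lemma tight_system_exists:
  assumes DIM: "DIM('a::euclidean_space) \<ge> 3"
  shows "\<exists>(V::'a set) \<E> F. tight_system (Suc k) V \<E> F"
proof (induction k)
  case 0
  \<comment> \<open>The basis vectors lie in the hyperplane \<open>One \<bullet> x = 1\<close> and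
    form the base of the initial simplex.\<close>
  define F :: "'a set" where "F = Basis"
  have indF: "\<not> affine_dependent F"
    unfolding F_def using affine_dependent_imp_dependent independent_Basis by blast
  have "One \<noteq> (0::'a)" using nonempty_Basis by (auto simp: One_neq_0)
  then have "\<exists>u l m. facet_chart F One u 1 l m"
    by (intro facet_chart_exists indF) (auto simp: F_def)
  then obtain u l m where "facet_chart F One u 1 l m" by blast
  then interpret C: facet_chart F One u 1 l m .
  define t where "t = C.apex 1"
  define \<E> where "\<E> = insert F ((\<lambda>f. insert t (F - {f})) ` F)"
  have tF: "t \<notin> F" using C.ht_F[of t] C.ht_apex[of 1] by (auto simp: t_def)
  have finF: "finite F" and cardF: "card F = DIM('a)" by (auto simp: F_def)
  have "\<exists>a b. facet_system (F \<union> {t}) \<E> a b"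
    using C.facet_system_simplex[of 1] unfolding t_def \<E>_def by force
  then obtain a b where fs: "facet_system (F \<union> {t}) \<E> a b" by blast
  have low: "2 \<le> card T" if T: "T \<subseteq> F \<union> {t}" "\<forall>E\<in>\<E>. T \<inter> E \<noteq> {}" for T
  proof -
    have finT: "finite T" using T(1) finF finite_subset by auto
    have F_hit: "T \<inter> F \<noteq> {}" using T(2) by (auto simp: \<E>_def)
    then obtain f where f: "f \<in> T" "f \<in> F" by blast
    then have "T \<inter> insert t (F - {f}) \<noteq> {}" using T(2) by (auto simp: \<E>_def)
    then obtain g where "g \<in> T" "g \<noteq> f" using tF f by blast
    then have "{f, g} \<subseteq> T" "card {f, g} = 2" using f by auto
    then show ?thesis using card_mono[OF finT] by metis
  qed
  have lowF: "3 \<le> card T" if T: "T \<subseteq> F \<union> {t}" "F \<subseteq> T" for T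
    using card_mono[of T F] T finF finite_subset[of T "F \<union> {t}"] cardF DIM by simp
  obtain T where T: "T \<subseteq> F" "card T = 2" using obtain_subset_with_card_n[of 2 F] cardF DIM by auto
  then obtain f g where fg: "T = {f, g}" "f \<noteq> g" by (auto simp: card_2_iff)
  have hit: "\<forall>E\<in>\<E>. T \<inter> E \<noteq> {}" using T fg by (auto simp: \<E>_def)
  have TF: "T \<inter> F = T" using T by blast
  have "tight_system (Suc 0) (F \<union> {t}) \<E> F"
    unfolding tight_system_def
  proof (intro exI conjI)
    show "facet_system (F \<union> {t}) \<E> a b" by fact
    show "card (F \<union> {t}) = Suc 0 * (DIM('a) + 1)" using tF finF cardF by simp
    show "F \<in> \<E>" by (simp add: \<E>_def)
    show "\<forall>T\<subseteq>F \<union> {t}. (\<forall>E\<in>\<E>. T \<inter> E \<noteq> {}) \<longrightarrow>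
        2 * Suc 0 \<le> card T \<and> (F \<subseteq> T \<longrightarrow> 2 * Suc 0 + 1 \<le> card T)"
      using low lowF by simp
    show "T \<subseteq> F \<union> {t}" "\<forall>E\<in>\<E>. T \<inter> E \<noteq> {}" "card T = 2 * Suc 0" "2 \<le> card (T \<inter> F)"
      using T hit TF by auto
  qed
  then show ?case by blast
next
  case (Suc k)
  then obtain V :: "'a set" and \<E> F where tight: "tight_system (Suc k) V \<E> F" by blast
  then obtain a b where fs: "facet_system V \<E> a b" unfolding tight_system_def by blast
  have cardV: "card V = Suc k * (DIM('a) + 1)" and F: "F \<in> \<E>"
    and low: "\<And>T. T \<subseteq> V \<Longrightarrow> \<forall>E\<in>\<E>. T \<inter> E \<noteq> {} \<Longrightarrow> 2 * Suc k \<le> card T"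
    and lowF: "\<And>T. T \<subseteq> V \<Longrightarrow> \<forall>E\<in>\<E>. T \<inter> E \<noteq> {} \<Longrightarrow> F \<subseteq> T \<Longrightarrow> 2 * Suc k + 1 \<le> card T"
    using tight unfolding tight_system_def by simp_all
  obtain T0 where T0: "T0 \<subseteq> V" "\<forall>E\<in>\<E>. T0 \<inter> E \<noteq> {}" "card T0 = 2 * Suc k" "2 \<le> card (T0 \<inter> F)"
    using tight unfolding tight_system_def by auto
  interpret P: facet_system V \<E> a b by fact
  have D2: "DIM('a) \<ge> 2" using DIM by simp
  have FV: "F \<subseteq> V" using P.facet_subset[OF F] .
  have finF: "finite F" using FV P.finite_V finite_subset by blast
  have cardF: "card F = DIM('a)" using P.card_facet[OF F] .
  have Fne: "F \<noteq> {}" using cardF by auto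
  obtain w a1 b1 where w: "inj_on w F" "w ` F \<inter> V = {}"
    and fs1: "facet_system (V \<union> w ` F) ((\<E> - {F}) \<union> (\<lambda>I. I \<union> w ` (F - I)) ` (Pow F - {F})) a1 b1"
    using P.facet_system_cross[OF F D2] by blast
  define \<E>1 where "\<E>1 = (\<E> - {F}) \<union> (\<lambda>I. I \<union> w ` (F - I)) ` (Pow F - {F})"
  interpret Q: facet_system "V \<union> w ` F" \<E>1 a1 b1 using fs1 by (simp add: \<E>1_def)
  \<comment> \<open>The empty \<open>I\<close> gives the facet opposite \<open>F\<close>, onto which
    \<open>t\<close> is stacked.\<close>
  have "{} \<in> Pow F - {F}" using Fne by auto
  then have "{} \<union> w ` (F - {}) \<in> \<E>1" unfolding \<E>1_def by blast
  then have wF: "w ` F \<in> \<E>1" by simp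
  obtain t a2 b2 where t: "t \<notin> V \<union> w ` F"
    and fs2: "facet_system (insert t (V \<union> w ` F)) ((\<E>1 - {w ` F}) \<union> (\<lambda>x. insert t (w ` F - {x})) ` (w ` F)) a2 b2"
    using Q.facet_system_stack[OF wF D2] by blast
  have wdiff: "w ` F - {w f} = w ` (F - {f})" if "f \<in> F" for f
    using w(1) that by (auto simp: inj_on_def)
  have top_eq: "(\<lambda>x. insert t (w ` F - {x})) ` (w ` F) = (\<lambda>f. insert t (w ` (F - {f}))) ` F"
    unfolding image_image by (intro image_cong refl) (simp add: wdiff)
  define \<E>2 where "\<E>2 = (\<E>1 - {w ` F}) \<union> (\<lambda>f. insert t (w ` (F - {f}))) ` F"
  have fs2': "facet_system (insert t (V \<union> w ` F)) \<E>2 a2 b2"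
    using fs2 by (simp add: \<E>2_def top_eq)
  have wFV: "w f \<notin> V" if "f \<in> F" for f using w(2) that by blast
  have wnotF: "w f \<notin> F" if "f \<in> F" for f using wFV[OF that] FV by blast
  have old: "E \<in> \<E>2" if E: "E \<in> \<E>" "E \<noteq> F" for E
  proof -
    have "E \<noteq> w ` F" using P.facet_subset[OF E(1)] wFV Fne by blast
    then show ?thesis using E by (auto simp: \<E>2_def \<E>1_def)
  qed
  \<comment> \<open>The choice \<open>I = F\<close> disappears in the first gluing and
    \<open>I = {}\<close> in the stacking; all others survive both.\<close>
  have cross: "I \<union> w ` (F - I) \<in> \<E>2" if I: "I \<subseteq> F" "I \<noteq> F" "I \<noteq> {}" for I
  proof -
    obtain i where i: "i \<in> I" using I(3) by blast
    then have "i \<notin> w ` F" using wnotF I(1) by auto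
    then have "I \<union> w ` (F - I) \<noteq> w ` F" using i by auto
    moreover have "I \<union> w ` (F - I) \<in> \<E>1"
      unfolding \<E>1_def by (intro UnI2 image_eqI[of _ _ I] refl) (use I in simp)
    ultimately show ?thesis by (simp add: \<E>2_def)
  qed
  have one_F: "insert f (w ` (F - {f})) \<in> \<E>2" if "f \<in> F" for f
  proof -
    have "{f} \<noteq> F" using cardF DIM by auto
    then show ?thesis using cross[of "{f}"] that by simp
  qed
  have one_w: "insert (w f) (F - {f}) \<in> \<E>2" if f: "f \<in> F" for f
  proof -
    have "F - {f} \<noteq> {}" using cardF DIM card_mono[of "{f}" F] by auto
    moreover have "F - (F - {f}) = {f}" "F - {f} \<noteq> F" using f by auto
    ultimately show ?thesis using cross[of "F - {f}"] by simp
  qed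
  have top: "insert t (w ` (F - {f})) \<in> \<E>2" if "f \<in> F" for f
    using that by (auto simp: \<E>2_def)
  obtain T1 where T1: "T1 \<subseteq> T0 \<inter> F" "card T1 = 2"
    using obtain_subset_with_card_n[OF T0(4)] by metis
  then obtain f g where fg: "T1 = {f, g}" "f \<noteq> g" by (auto simp: card_2_iff)
  have fgF: "f \<in> F" "g \<in> F" "f \<in> T0" "g \<in> T0" using T1 fg by auto
  have "\<not> F \<subseteq> {f, g}" using card_mono[of "{f, g}" F] cardF DIM fg by auto
  then obtain c where c: "c \<in> F" "c \<noteq> f" "c \<noteq> g" by blast
  define G where "G = insert t (w ` (F - {c}))"
  define T where "T = T0 \<union> {w f, w g}"
  have wfg: "w f \<noteq> w g" using w(1) fgF fg by (auto simp: inj_on_def)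
  have "tight_system (Suc (Suc k)) (insert t (V \<union> w ` F)) \<E>2 G"
    unfolding tight_system_def
  proof (intro exI conjI)
    show "facet_system (insert t (V \<union> w ` F)) \<E>2 a2 b2" by fact
    have "card (V \<union> w ` F) = card V + DIM('a)"
      using P.finite_V finF w card_image[OF w(1)] cardF by (subst card_Un_disjoint) auto
    then show "card (insert t (V \<union> w ` F)) = Suc (Suc k) * (DIM('a) + 1)"
      using t P.finite_V finF cardV by simp
    show "G \<in> \<E>2" unfolding G_def by (rule top[OF c(1)])
    show "\<forall>T\<subseteq>insert t (V \<union> w ` F). (\<forall>E\<in>\<E>2. T \<inter> E \<noteq> {}) \<longrightarrow>
        2 * Suc (Suc k) \<le> card T \<and> (G \<subseteq> T \<longrightarrow> 2 * Suc (Suc k) + 1 \<le> card T)"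
    proof (intro allI impI)
      fix T assume T: "T \<subseteq> insert t (V \<union> w ` F)" and hit: "\<forall>E\<in>\<E>2. T \<inter> E \<noteq> {}"
      have F3: "3 \<le> card F" using cardF DIM by simp
      have t': "t \<notin> V" "t \<notin> w ` F" using t by auto
      note step = transversal_card_step[OF P.finite_V P.facet_subset F F3 w t' low lowF T
        bspec[OF hit old] bspec[OF hit one_F] bspec[OF hit one_w] bspec[OF hit top]]
      have "2 * Suc k + 2 \<le> card T" by (rule step(1))
      moreover have "2 * Suc k + 3 \<le> card T" if "G \<subseteq> T"
        by (rule step(2)[where c = c]) (use c that in \<open>auto simp: G_def\<close>)
      ultimately show "2 * Suc (Suc k) \<le> card T \<and> (G \<subseteq> T \<longrightarrow> 2 * Suc (Suc k) + 1 \<le> card T)"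
        by (intro conjI impI) simp_all
    qed
    show "T \<subseteq> insert t (V \<union> w ` F)" using T0 fgF by (auto simp: T_def)
    show "\<forall>E\<in>\<E>2. T \<inter> E \<noteq> {}"
    proof
      fix E assume "E \<in> \<E>2"
      then consider "E \<in> \<E>" | I where "E = I \<union> w ` (F - I)" | x where "x \<in> F" "E = insert t (w ` (F - {x}))"
        unfolding \<E>2_def \<E>1_def by blast
      then show "T \<inter> E \<noteq> {}"
      proof cases
        case 1
        then show ?thesis using T0(2) by (auto simp: T_def)
      next
        case 2
        \<comment> \<open>A cross-polytope facet contains a member of the antipodal pair
          \<open>f\<close>, \<open>w f\<close>, and \<open>T\<close> contains both.\<close>
        then have "f \<in> E \<or> w f \<in> E" using fgF by blast
        then show ?thesis using fgF by (auto simp: T_def)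
      next
        case 3
        \<comment> \<open>A stacked facet omits only one antipode.\<close>
        then have "w f \<in> E \<or> w g \<in> E" using fgF fg by blast
        then show ?thesis by (auto simp: T_def)
      qed
    qed
    have "finite T0" using T0(1) P.finite_V finite_subset by blast
    moreover have "T0 \<inter> {w f, w g} = {}" using T0(1) wFV fgF by blast
    ultimately show "card T = 2 * Suc (Suc k)"
      unfolding T_def using T0(3) wfg by (subst card_Un_disjoint) auto
    have "{w f, w g} \<subseteq> T \<inter> G" using c fgF by (auto simp: T_def G_def)
    moreover have "finite (T \<inter> G)" using finF by (auto simp: G_def)
    ultimately have "card {w f, w g} \<le> card (T \<inter> G)" using card_mono by blast
    then show "2 \<le> card (T \<inter> G)" using wfg by simp
  qed
  then show ?case by blast
qed

theorem theorem1p2: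
  fixes d N :: nat
  assumes "d \<ge> 2" and "DIM('a::euclidean_space) = d + 1"
  shows "\<exists>P :: 'a set. simplicial_polytope P \<and> aff_dim P = int (d + 1) \<and>
           card (vertices P) \<ge> N \<and>
           real (transversal_number P) / real (card (vertices P)) = 2 / (real d + 2)"
proof -
  \<comment> \<open>The index \<open>Suc N\<close> is positive, so it cancels in the ratio, and it
    makes the number of vertices at least \<open>N\<close>.\<close>
  obtain V :: "'a set" and \<E> F where tight: "tight_system (Suc N) V \<E> F"
    using tight_system_exists assms by force
  then obtain a b where fs: "facet_system V \<E> a b" unfolding tight_system_def by blast
  have cardV: "card V = Suc N * (d + 2)"
    and low: "\<And>T. T \<subseteq> V \<Longrightarrow> \<forall>E\<in>\<E>. T \<inter> E \<noteq> {} \<Longrightarrow> 2 * Suc N \<le> card T"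
    using tight assms(2) unfolding tight_system_def by simp_all
  obtain T where T: "T \<subseteq> V" "\<forall>E\<in>\<E>. T \<inter> E \<noteq> {}" "card T = 2 * Suc N"
    using tight unfolding tight_system_def by auto
  interpret P: facet_system V \<E> a b by fact
  have "transversal_number (convex hull V) = 2 * Suc N"
    unfolding transversal_number_def is_transversal_def P.vertices_hull P.facet_hypergraph_edges_hull
    by (rule Least_equality) (use low T in auto)
  moreover have "real (2 * Suc N) / real (Suc N * (d + 2)) = 2 / (real d + 2)"
    by (simp add: divide_simps del: of_nat_Suc) (simp add: algebra_simps)
  moreover have "N \<le> Suc N * (d + 2)" by simp
  ultimately show ?thesis
    using P.simplicial P.aff_dim_hull P.vertices_hull cardV assms(2) by (intro exI[of _ "convex hull V"]) simp
qed

end
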